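(* Let $L$ be a lattice with minimum element $0$ and let $M$ be an ideal of $L$. The following conditions are equivalent: (1) $M\in S(L)$, i.e. $M$ is a special ideal. (2) If $\bigcap_{\lambda\in\Lambda}I_{\lambda}\subseteq M$, where $\{I_{\lambda}\}_{\lambda\in\Lambda}$ is a family of ideals of $L$, then $I_{\lambda}\subseteq M$ for some $\lambda\in\Lambda$. (3) $M$ is the unique value of $x$ for some $x\in M^{*}\setminus M$.
   Context: An ideal of $L$ is a nonempty subset closed under $\vee$ and downward closed. For $0<x\in L$, a value of $x$ is an ideal of $L$ maximal (under inclusion) among the ideals not containing $x$. An ideal $M$ is special if there is some $0<x\in L$ such that $M$ is the unique value of $x$; $S(L)$ is the set of all special ideals of $L$. $M^{*}=\bigcap\{I \text{ an ideal of } L\mid I\supset M\}$, where $\supset$ denotes proper inclusion. *)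

theory Defs
  imports Main
begin

definition lattice_ideal :: "'a::bounded_lattice_bot set \<Rightarrow> bool" where
  "lattice_ideal I \<longleftrightarrow>
     I \<noteq> {} \<and> (\<forall>a\<in>I. \<forall>b\<in>I. sup a b \<in> I) \<and> (\<forall>a\<in>I. \<forall>b. b \<le> a \<longrightarrow> b \<in> I)"

definition value_of :: "'a::bounded_lattice_bot \<Rightarrow> 'a set \<Rightarrow> bool" where
  "value_of x M \<longleftrightarrow>
     bot < x \<and> lattice_ideal M \<and> x \<notin> M \<and>
     (\<forall>N. lattice_ideal N \<and> x \<notin> N \<and> M \<subseteq> N \<longrightarrow> N = M)"

definition unique_value_of :: "'a::bounded_lattice_bot \<Rightarrow> 'a set \<Rightarrow> bool" where
  "unique_value_of x M \<longleftrightarrow> value_of x M \<and> (\<forall>N. value_of x N \<longrightarrow> N = M)"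

definition special_ideals :: "'a::bounded_lattice_bot set set" where
  "special_ideals = {M. lattice_ideal M \<and> (\<exists>x>bot. unique_value_of x M)}"

(* For M = UNIV no ideal properly contains M; the empty intersection is UNIV. *)
definition ideal_cover :: "'a::bounded_lattice_bot set \<Rightarrow> 'a set" where
  "ideal_cover M = \<Inter>{I. lattice_ideal I \<and> M \<subset> I}"

end

theory Submission
  imports Defs
begin

text \<open>
  Everything rests on one reformulation (\<open>unique_value_of_iff\<close>): \<open>M\<close> is the unique value of \<open>x\<close>
  exactly when \<open>M\<close> is the largest ideal that avoids \<open>x\<close>.  This needs Zorn's lemma, which puts
  every ideal avoiding \<open>x\<close> below some value of \<open>x\<close> (\<open>ideal_le_value\<close>).

  If \<open>M\<close> is the largest ideal avoiding \<open>x\<close> and \<open>\<Inter>F \<subseteq> M\<close>, then \<open>x\<close> is missed by some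
  \<open>I \<in> F\<close>, which therefore lies in \<open>M\<close>.  Conversely, apply the intersection property to the family
  of all ideals not contained in \<open>M\<close>: no member lies in \<open>M\<close>, so the intersection contains some
  \<open>x \<notin> M\<close>, and every ideal avoiding this \<open>x\<close> lies in \<open>M\<close>.  Finally, an ideal properly above a value
  of \<open>x\<close> must contain \<open>x\<close>, so the witness of speciality lies in the cover of \<open>M\<close> automatically.
\<close>

lemma bot_in_lattice_ideal:
  "lattice_ideal I \<Longrightarrow> bot \<in> I"
  unfolding lattice_ideal_def by (meson bot_least ex_in_conv)

lemma lattice_ideal_Union_chain:
  assumes "\<C> \<noteq> {}" and "subset.chain {I. lattice_ideal I} \<C>"
  shows "lattice_ideal (\<Union>\<C>)"
proof -
  have ideals: "lattice_ideal I" if "I \<in> \<C>" for I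
    using assms(2) that by (auto simp: subset_chain_def)
  have "sup a b \<in> \<Union>\<C>" if ab: "a \<in> \<Union>\<C>" "b \<in> \<Union>\<C>" for a b
  proof -
    obtain I J where IJ: "I \<in> \<C>" "a \<in> I" "J \<in> \<C>" "b \<in> J"
      using ab by blast
    then have "I \<subseteq> J \<or> J \<subseteq> I"
      using assms(2) by (auto simp: subset_chain_def)
    then obtain K where K: "K \<in> \<C>" "a \<in> K" "b \<in> K"
      using IJ by blast
    then have "sup a b \<in> K"
      using ideals[of K] by (auto simp: lattice_ideal_def)
    then show ?thesis
      using K by blast
  qed
  moreover have "b \<in> \<Union>\<C>" if ab: "a \<in> \<Union>\<C>" "b \<le> a" for a b
  proof -
    obtain I where I: "I \<in> \<C>" "a \<in> I"
      using ab(1) by blast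
    then have "b \<in> I"
      using ideals[of I] ab(2) unfolding lattice_ideal_def by blast
    then show ?thesis
      using I by blast
  qed
  moreover have "\<Union>\<C> \<noteq> {}"
    using assms(1) bot_in_lattice_ideal[OF ideals] by auto
  ultimately show ?thesis
    unfolding lattice_ideal_def by blast
qed

text \<open>
  Unions of chains of ideals avoiding \<open>x\<close> are again ideals avoiding \<open>x\<close>, so Zorn's lemma applies to
  the ideals above \<open>I\<close> that avoid \<open>x\<close>.
\<close>

lemma ideal_le_value:
  assumes "lattice_ideal I" and "x \<notin> I"
  obtains N where "value_of x N" and "I \<subseteq> N"
proof -
  define A where "A = {J. lattice_ideal J \<and> x \<notin> J \<and> I \<subseteq> J}"
  have "A \<noteq> {}"
    using assms by (auto simp: A_def)
  moreover have "\<Union>\<C> \<in> A" if "\<C> \<noteq> {}" "subset.chain A \<C>" for \<C>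
  proof -
    have "subset.chain {J. lattice_ideal J} \<C>"
      using that(2) by (auto simp: subset_chain_def A_def)
    then have "lattice_ideal (\<Union>\<C>)"
      using that(1) by (rule lattice_ideal_Union_chain[rotated])
    then show ?thesis
      using that by (fastforce simp: subset_chain_def A_def)
  qed
  ultimately obtain N where N: "N \<in> A" "\<forall>J\<in>A. N \<subseteq> J \<longrightarrow> J = N"
    using subset_Zorn_nonempty[of A] by blast
  have "bot < x"
    using assms bot_in_lattice_ideal bot.not_eq_extremum by metis
  then have "value_of x N"
    using N unfolding value_of_def A_def by blast
  then show ?thesis
    using N that by (auto simp: A_def)
qed

lemma unique_value_of_iff:
  "unique_value_of x M \<longleftrightarrow>
     lattice_ideal M \<and> x \<notin> M \<and> (\<forall>I. lattice_ideal I \<and> x \<notin> I \<longrightarrow> I \<subseteq> M)"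
proof
  assume "unique_value_of x M"
  then have M: "value_of x M" and uniq: "\<And>N. value_of x N \<Longrightarrow> N = M"
    by (auto simp: unique_value_of_def)
  have "I \<subseteq> M" if I: "lattice_ideal I" "x \<notin> I" for I
  proof -
    obtain N where "value_of x N" "I \<subseteq> N"
      using I by (rule ideal_le_value)
    then show ?thesis
      using uniq[of N] by simp
  qed
  then show "lattice_ideal M \<and> x \<notin> M \<and> (\<forall>I. lattice_ideal I \<and> x \<notin> I \<longrightarrow> I \<subseteq> M)"
    using M by (auto simp: value_of_def)
next
  assume M: "lattice_ideal M \<and> x \<notin> M \<and> (\<forall>I. lattice_ideal I \<and> x \<notin> I \<longrightarrow> I \<subseteq> M)"
  then have "bot < x"
    using bot_in_lattice_ideal bot.not_eq_extremum by metis
  then show "unique_value_of x M"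
    using M by (auto simp: unique_value_of_def value_of_def)
qed

lemma special_ideals_iff:
  "M \<in> special_ideals \<longleftrightarrow> (\<exists>x. unique_value_of x M)"
  unfolding special_ideals_def unique_value_of_def value_of_def by blast

lemma value_in_cover:
  "value_of x M \<Longrightarrow> x \<in> ideal_cover M - M"
  unfolding value_of_def ideal_cover_def by blast

text \<open>
  Allowing \<open>F = {}\<close>, whose intersection is the whole lattice, is what excludes the improper ideal
  on the right-hand side.
\<close>

lemma special_iff_completely_meet_prime:
  assumes "lattice_ideal M"
  shows "M \<in> special_ideals \<longleftrightarrow>
           (\<forall>F. (\<forall>I\<in>F. lattice_ideal I) \<and> \<Inter>F \<subseteq> M \<longrightarrow> (\<exists>I\<in>F. I \<subseteq> M))"
    (is "_ \<longleftrightarrow> ?prime")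
proof
  assume "M \<in> special_ideals"
  then obtain x where "x \<notin> M" and largest: "\<And>I. lattice_ideal I \<Longrightarrow> x \<notin> I \<Longrightarrow> I \<subseteq> M"
    unfolding special_ideals_iff unique_value_of_iff by auto
  then have "\<exists>I\<in>F. I \<subseteq> M" if F: "\<forall>I\<in>F. lattice_ideal I" "\<Inter>F \<subseteq> M" for F
  proof -
    obtain I where "I \<in> F" "x \<notin> I"
      using \<open>x \<notin> M\<close> F(2) by blast
    then show ?thesis
      using largest[of I] F(1) by auto
  qed
  then show ?prime
    by blast
next
  assume prime: ?prime
  define F where "F = {I. lattice_ideal I \<and> \<not> I \<subseteq> M}"
  have "\<not> \<Inter>F \<subseteq> M"
    using prime[rule_format, of F] by (auto simp: F_def)
  then obtain x where "x \<in> \<Inter>F" "x \<notin> M"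
    by blast
  then have "\<forall>I. lattice_ideal I \<and> x \<notin> I \<longrightarrow> I \<subseteq> M"
    unfolding F_def by blast
  then have "unique_value_of x M"
    using assms \<open>x \<notin> M\<close> by (simp add: unique_value_of_iff)
  then show "M \<in> special_ideals"
    unfolding special_ideals_iff by blast
qed

theorem theorem5p1:
  fixes M :: "'a::bounded_lattice_bot set"
  assumes "lattice_ideal M"
  shows "(M \<in> special_ideals \<longleftrightarrow>
            (\<forall>F. (\<forall>I\<in>F. lattice_ideal I) \<and> \<Inter>F \<subseteq> M \<longrightarrow> (\<exists>I\<in>F. I \<subseteq> M)))
       \<and> (M \<in> special_ideals \<longleftrightarrow>
            (\<exists>x \<in> ideal_cover M - M. unique_value_of x M))"
proof
  show "M \<in> special_ideals \<longleftrightarrow>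
          (\<forall>F. (\<forall>I\<in>F. lattice_ideal I) \<and> \<Inter>F \<subseteq> M \<longrightarrow> (\<exists>I\<in>F. I \<subseteq> M))"
    using assms by (rule special_iff_completely_meet_prime)
  show "M \<in> special_ideals \<longleftrightarrow> (\<exists>x \<in> ideal_cover M - M. unique_value_of x M)"
    unfolding special_ideals_iff
    using value_in_cover by (auto simp: unique_value_of_def)
qed

end
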